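(* Let $d \geq 2$ and $k$ be fixed positive integers. Then every $d$-Horton set $H$ with $n$ points contains at least $\Omega(n^{\min\{2^{d-1},k\}})$ $k$-islands in $H$ (the implied constant depending only on $d$ and $k$). If $k \leq 3 \cdot 2^{d-1}$, then $H$ even contains at least $\Omega(n^{\min\{2^{d-1},k\}})$ $k$-holes in $H$.
   Context: A finite set $S\subseteq\mathbb{R}^d$ is in general position if for every $i=1,\dots,d-1$ no $i+2$ points of $S$ lie in an $i$-dimensional affine subspace. A set $I$ of $k$ points of $S$ is a $k$-island in $S$ if $\mathrm{conv}(I)\cap S=I$; it is a $k$-hole if moreover $I$ is in convex position (equivalently, $I$ is in convex position and the interior of $\mathrm{conv}(I)$ contains no point of $S$). A set $Q\subseteq\mathbb{R}^d$ is in strongly general position if it is in general position and, for every $i=1,\dots,d-1$, no $(i+1)$-tuple of points of $Q$ spans an $i$-dimensional affine subspace parallel to the $(d-i)$-dimensional linear subspace containing the last $d-i$ coordinate axes. Let $\pi:\mathbb{R}^d\to\mathbb{R}^{d-1}$, $\pi(x_1,\dots,x_d)=(x_1,\dots,x_{d-1})$. If $Q=\{q_0,\dots,q_{n-1}\}$ is in strongly general position with the points ordered by increasing first coordinate, then for $m\in\mathbb{N}$ and $i\in\{0,\dots,m-1\}$ let $Q_{i,m}=\{q_j: j\equiv i \pmod m\}$. For $A,B\subseteq\mathbb{R}^d$ with $|A|,|B|\ge d$, $B$ is deep below $A$ (and $A$ high above $B$) if $B$ lies entirely below every hyperplane determined by $d$ points of $A$ and $A$ lies entirely above every hyperplane determined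 by $d$ points of $B$. For arbitrary finite $A',B'$, $B'$ is deep below $A'$ if there are $A\supseteq A'$, $B\supseteq B'$ with $|A|,|B|\ge d$ and $B$ deep below $A$. Let $p_2<p_3<p_4<\cdots$ be the primes ($p_2=2$, $p_3=3$, $p_4=5,\dots$). Every finite set in $\mathbb{R}$ is $1$-Horton. For $d\ge2$, a finite set $H\subseteq\mathbb{R}^d$ in strongly general position is $d$-Horton if either $|H|\le 1$, or: (i) if $d>2$ then $\pi(H)$ is $(d-1)$-Horton; (ii) for every $i\in\{0,\dots,p_d-1\}$ the set $H_{i,p_d}$ is $d$-Horton; (iii) every $I\subseteq\{0,\dots,p_d-1\}$ with $|I|\ge2$ can be partitioned into nonempty $J$ and $I\setminus J$ such that $\bigcup_{j\in J}H_{j,p_d}$ lies deep below $\bigcup_{i\in I\setminus J}H_{i,p_d}$. *)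

theory Defs
  imports "HOL-Analysis.Analysis" "HOL-Analysis.Finite_Function_Topology" "HOL-Computational_Algebra.Primes" "HOL-Library.Infinite_Set"
begin

text \<open>The Horton condition in dimension \<open>d\<close> refers to dimension \<open>d - 1\<close>, so the dimension cannot
  be a type. All the spaces \<open>\<real>\<^sup>d\<close> live in the real vector space of finitely supported sequences:
  \<open>\<real>\<^sup>d\<close> is \<open>coord_space d\<close>, and \<open>lookup x i\<close> is the coordinate \<open>x\<^sub>i\<^sub>+\<^sub>1\<close>.\<close>

type_synonym point = "nat \<Rightarrow>\<^sub>0 real"

definition coord_space :: "nat \<Rightarrow> point set" where
  "coord_space d = {x. Poly_Mapping.keys x \<subseteq> {..<d}}"

definition direction :: "point set \<Rightarrow> point set" where
  "direction A = {x - y | x y. x \<in> A \<and> y \<in> A}"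

definition affine_subspace :: "nat \<Rightarrow> nat \<Rightarrow> point set \<Rightarrow> bool" where
  "affine_subspace d i A \<longleftrightarrow>
     A \<subseteq> coord_space d \<and> A \<noteq> {} \<and> affine A \<and> dim (direction A) = i"

definition parallel_subspaces :: "point set \<Rightarrow> point set \<Rightarrow> bool" where
  "parallel_subspaces A B \<longleftrightarrow> direction A \<subseteq> direction B \<or> direction B \<subseteq> direction A"

definition last_axes_space :: "nat \<Rightarrow> nat \<Rightarrow> point set" where
  "last_axes_space d m = span {Poly_Mapping.single j 1 | j. d - m \<le> j \<and> j < d}"

definition general_position :: "nat \<Rightarrow> point set \<Rightarrow> bool" where
  "general_position d S \<longleftrightarrow>
     finite S \<and> S \<subseteq> coord_space d \<and>
     (\<forall>i\<in>{1..d - 1}. \<not> (\<exists>T A. T \<subseteq> S \<and> card T = i + 2 \<and> affine_subspace d i A \<and> T \<subseteq> A))"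

definition strongly_general_position :: "nat \<Rightarrow> point set \<Rightarrow> bool" where
  "strongly_general_position d Q \<longleftrightarrow>
     general_position d Q \<and>
     (\<forall>i\<in>{1..d - 1}. \<not> (\<exists>T\<subseteq>Q. card T = i + 1 \<and> affine_subspace d i (affine hull T) \<and>
        parallel_subspaces (affine hull T) (last_axes_space d (d - i))))"

definition first_coords :: "nat \<Rightarrow> point \<Rightarrow> point" where
  "first_coords m x = (\<Sum>i<m. Poly_Mapping.single i (Poly_Mapping.lookup x i))"

text \<open>In the order by increasing first coordinate, the index of \<open>q\<close> is the number of points
  with smaller first coordinate (in strongly general position, with \<open>d \<ge> 2\<close>, the first
  coordinates are distinct).\<close>

definition point_index :: "point set \<Rightarrow> point \<Rightarrow> nat" where
  "point_index Q q = card {r \<in> Q. Poly_Mapping.lookup r 0 < Poly_Mapping.lookup q 0}"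

definition residue_part :: "point set \<Rightarrow> nat \<Rightarrow> nat \<Rightarrow> point set" where
  "residue_part Q i m = {q \<in> Q. point_index Q q mod m = i mod m}"

text \<open>No point is below or above a vertical hyperplane: the first conjunct fails for a point off
  the hyperplane, and the second for a point on it.\<close>

definition lies_below :: "nat \<Rightarrow> point \<Rightarrow> point set \<Rightarrow> bool" where
  "lies_below d x P \<longleftrightarrow>
     (\<exists>y\<in>P. first_coords (d - 1) y = first_coords (d - 1) x) \<and>
     (\<forall>y\<in>P. first_coords (d - 1) y = first_coords (d - 1) x \<longrightarrow>
        Poly_Mapping.lookup x (d - 1) < Poly_Mapping.lookup y (d - 1))"

definition lies_above :: "nat \<Rightarrow> point \<Rightarrow> point set \<Rightarrow> bool" where
  "lies_above d x P \<longleftrightarrow>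
     (\<exists>y\<in>P. first_coords (d - 1) y = first_coords (d - 1) x) \<and>
     (\<forall>y\<in>P. first_coords (d - 1) y = first_coords (d - 1) x \<longrightarrow>
        Poly_Mapping.lookup y (d - 1) < Poly_Mapping.lookup x (d - 1))"

definition determined_hyperplanes :: "nat \<Rightarrow> point set \<Rightarrow> point set set" where
  "determined_hyperplanes d A =
     {affine hull T | T. T \<subseteq> A \<and> card T = d \<and> affine_subspace d (d - 1) (affine hull T)}"

definition deep_below_large :: "nat \<Rightarrow> point set \<Rightarrow> point set \<Rightarrow> bool" where
  "deep_below_large d B A \<longleftrightarrow>
     (\<forall>P\<in>determined_hyperplanes d A. \<forall>b\<in>B. lies_below d b P) \<and>
     (\<forall>P\<in>determined_hyperplanes d B. \<forall>a\<in>A. lies_above d a P)"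

definition deep_below :: "nat \<Rightarrow> point set \<Rightarrow> point set \<Rightarrow> bool" where
  "deep_below d B' A' \<longleftrightarrow>
     (\<exists>A B. A' \<subseteq> A \<and> B' \<subseteq> B \<and> finite A \<and> finite B \<and> A \<subseteq> coord_space d \<and> B \<subseteq> coord_space d \<and>
        d \<le> card A \<and> d \<le> card B \<and> deep_below_large d B A)"

definition horton_prime :: "nat \<Rightarrow> nat" where
  "horton_prime d = enumerate {p. prime p} (d - 2)"

inductive horton :: "nat \<Rightarrow> point set \<Rightarrow> bool" where
  line: "finite H \<Longrightarrow> H \<subseteq> coord_space 1 \<Longrightarrow> horton 1 H"
| small: "2 \<le> d \<Longrightarrow> strongly_general_position d H \<Longrightarrow> card H \<le> 1 \<Longrightarrow> horton d H"
| split: "2 \<le> d \<Longrightarrow> strongly_general_position d H \<Longrightarrow>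
    (2 < d \<longrightarrow> horton (d - 1) (first_coords (d - 1) ` H)) \<Longrightarrow>
    (\<forall>i<horton_prime d. horton d (residue_part H i (horton_prime d))) \<Longrightarrow>
    (\<forall>I\<subseteq>{..<horton_prime d}. 2 \<le> card I \<longrightarrow>
       (\<exists>J\<subseteq>I. J \<noteq> {} \<and> I - J \<noteq> {} \<and>
          deep_below d (\<Union>j\<in>J. residue_part H j (horton_prime d))
                       (\<Union>i\<in>I - J. residue_part H i (horton_prime d)))) \<Longrightarrow>
    horton d H"

definition is_island :: "point set \<Rightarrow> nat \<Rightarrow> point set \<Rightarrow> bool" where
  "is_island S k I \<longleftrightarrow> I \<subseteq> S \<and> card I = k \<and> (convex hull I) \<inter> S = I"

definition convex_position :: "point set \<Rightarrow> bool" where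
  "convex_position I \<longleftrightarrow> (\<forall>x\<in>I. x \<notin> convex hull (I - {x}))"

definition is_hole :: "point set \<Rightarrow> nat \<Rightarrow> point set \<Rightarrow> bool" where
  "is_hole S k I \<longleftrightarrow> is_island S k I \<and> convex_position I"

end

theory Submission
  imports Defs
begin

text \<open>Let \<open>d \<ge> 2\<close>. Recursive splitting of the residue classes mod \<open>p\<^sub>d\<close> of a \<open>d\<close>-Horton set \<open>H\<close> leads to two
  classes \<open>A\<close>, \<open>B\<close> such that \<open>B\<close> is deep below \<open>A\<close> and every other class is deep above or deep below
  \<open>A \<union> B\<close>. If the projections of \<open>E \<subseteq> A\<close> and \<open>F \<subseteq> B\<close> are islands (holes) in the projections of \<open>A\<close>
  and \<open>B\<close>, then \<open>E \<union> F\<close> is an island (a hole) in \<open>H\<close>: a functional separating \<open>x \<in> A\<close> from \<open>E\<close> can be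
  rotated to a hyperplane through \<open>x\<close> and \<open>d - 1\<close> further points of \<open>A\<close>, which lies above all of \<open>B\<close>, and
  a small perturbation then separates \<open>x\<close> from \<open>E \<union> F\<close>. Splitting \<open>k\<close> into halves thus doubles the exponent with
  each dimension, starting from intervals of consecutive points on the line. For holes in the plane one
  needs in addition that a triple of consecutive points of \<open>A\<close> (of \<open>B\<close>) forms a cap (a cup), which
  holds for every other triple.\<close>

section \<open>Coordinates and general position\<close>

abbreviation unit_vec :: "nat \<Rightarrow> point" where
  "unit_vec i \<equiv> Poly_Mapping.single i 1"

abbreviation coord :: "nat \<Rightarrow> point \<Rightarrow> real" where
  "coord i x \<equiv> Poly_Mapping.lookup x i"

lemma coord_scaleR [simp]: "coord i (r *\<^sub>R x) = r * coord i x"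
proof -
  have "finite {i. r * coord i x \<noteq> 0}"
    by (rule finite_subset[OF _ finite_keys[of x]]) (auto simp: in_keys_iff)
  then show ?thesis
    by (simp add: scaleR_poly_mapping_def Abs_poly_mapping_inverse)
qed

lemma linear_coord: "linear (coord i)"
  by (rule linearI) (simp_all add: lookup_add)

lemma coord_first_coords: "coord i (first_coords m x) = (if i < m then coord i x else 0)"
  by (simp add: first_coords_def lookup_sum lookup_single when_def)

lemma linear_first_coords: "linear (first_coords m)"
  by (rule linearI) (auto intro!: poly_mapping_eqI simp: coord_first_coords lookup_add)

lemma first_coords_unit_vec: "m \<le> i \<Longrightarrow> first_coords m (unit_vec i) = 0"
  by (rule poly_mapping_eqI) (auto simp: coord_first_coords lookup_single)

lemma mem_coord_space: "x \<in> coord_space d \<longleftrightarrow> (\<forall>i\<ge>d. coord i x = 0)"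
  by (auto simp: coord_space_def in_keys_iff subset_iff not_less[symmetric])

lemma subspace_coord_space: "subspace (coord_space d)"
  by (auto simp: subspace_def mem_coord_space lookup_add)

lemma first_coords_split:
  assumes "x \<in> coord_space d" "1 \<le> d"
  shows "x = first_coords (d - 1) x + coord (d - 1) x *\<^sub>R unit_vec (d - 1)"
  using assms
  by (intro poly_mapping_eqI) (auto simp: coord_first_coords lookup_add lookup_single mem_coord_space when_def)

text \<open>A functional that vanishes on the vertical axis factors through the projection to the
  first \<open>d - 1\<close> coordinates.\<close>

lemma linear_eq_if_first_coords_eq:
  assumes f: "linear f" "f (unit_vec (d - 1)) = 0"
    and "x \<in> coord_space d" "y \<in> coord_space d" "1 \<le> d"
    and "first_coords (d - 1) x = first_coords (d - 1) y"
  shows "f x = (f y :: real)"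
proof -
  have "f w = f (first_coords (d - 1) w)" if "w \<in> coord_space d" for w
    by (subst first_coords_split[OF that \<open>1 \<le> d\<close>]) (simp add: linear_add[OF f(1)] linear_scale[OF f(1)] f(2) del: One_nat_def)
  then show ?thesis using assms by simp
qed

lemma affine_hull_subset_coord_space:
  assumes "T \<subseteq> coord_space d" shows "affine hull T \<subseteq> coord_space d"
  using assms by (intro hull_minimal subspace_imp_affine subspace_coord_space)

lemma direction_affine_hull:
  assumes "a \<in> S"
  shows "direction (affine hull S) = span ((\<lambda>x. x - a) ` (S - {a}))"
proof -
  have *: "affine hull S = (\<lambda>x. a + x) ` span ((\<lambda>x. x - a) ` (S - {a}))"
    using affine_hull_span2[OF assms] by simp
  let ?W = "span ((\<lambda>x. x - a) ` (S - {a}))"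
  show ?thesis
  proof (intro subset_antisym subsetI)
    fix x assume "x \<in> direction (affine hull S)"
    then obtain u v where "x = (a + u) - (a + v)" "u \<in> ?W" "v \<in> ?W"
      unfolding direction_def * by auto
    then show "x \<in> ?W" by (simp add: span_diff)
  next
    fix x assume "x \<in> ?W"
    then have "a + x \<in> affine hull S" "a + 0 \<in> affine hull S" unfolding * by (auto simp: span_zero)
    then show "x \<in> direction (affine hull S)" unfolding direction_def by force
  qed
qed

lemma direction_span: "direction (span B) = span B"
proof -
  have "x \<in> direction (span B)" if "x \<in> span B" for x
    unfolding direction_def using that span_zero[of B] by force
  then show ?thesis by (auto simp: direction_def span_diff)
qed

text \<open>If the hull of \<open>T\<close> had dimension \<open>r < d - 1\<close>, then
  \<open>r + 2\<close> of the \<open>d\<close> points would lie in an \<open>r\<close>-dimensional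
  subspace. The case \<open>r = 0\<close> needs its own argument, because general position only
  speaks of dimensions from 1 on: there all points would coincide.\<close>

lemma general_position_hyperplane:
  assumes gp: "general_position d S" and "2 \<le> d" "T \<subseteq> S" "card T = d"
  shows "affine_subspace d (d - 1) (affine hull T)"
proof -
  have fin: "finite T" and TS: "T \<subseteq> coord_space d"
    using assms by (auto simp: general_position_def intro: finite_subset)
  from assms obtain a where a: "a \<in> T" by fastforce
  let ?V = "(\<lambda>x. x - a) ` (T - {a})"
  let ?r = "dim (direction (affine hull T))"
  have dir: "direction (affine hull T) = span ?V" by (rule direction_affine_hull[OF a])
  have cV: "card ?V = d - 1"
    using a fin assms(4) by (subst card_image) (auto simp: inj_on_def)
  have le: "?r \<le> d - 1"
    using dim_le_card[of ?V ?V] fin cV by (auto simp: dir intro: span_base)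
  have aff: "affine_subspace d ?r (affine hull T)"
    using affine_hull_subset_coord_space[OF TS] a by (auto simp: affine_subspace_def hull_inc)
  have "?r \<noteq> 0"
  proof
    assume "?r = 0"
    obtain B where B: "B \<subseteq> ?V" "independent B" "?V \<subseteq> span B" "card B = dim ?V"
      using basis_exists by blast
    have "B = {}"
      using B(1,4) \<open>?r = 0\<close> fin by (auto simp: dir dest: finite_subset)
    then have "?V \<subseteq> {0}" using B by auto
    moreover have "0 \<notin> ?V" by auto
    ultimately have "?V = {}" by (metis singletonI subset_singletonD)
    then have "card ?V = 0" by (metis card.empty)
    then show False using cV assms(2) by linarith
  qed
  have "?r = d - 1"
  proof (rule ccontr)
    assume "?r \<noteq> d - 1"
    then have "?r + 2 \<le> card T" using le assms by linarith
    then obtain T' where "T' \<subseteq> T" "card T' = ?r + 2"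
      by (meson obtain_subset_with_card_n)
    then have "\<exists>T A. T \<subseteq> S \<and> card T = ?r + 2 \<and> affine_subspace d ?r A \<and> T \<subseteq> A"
      using aff assms(3) hull_subset[of T affine] by blast
    moreover have "?r \<in> {1..d - 1}" using \<open>?r \<noteq> 0\<close> le by auto
    ultimately show False using gp unfolding general_position_def by blast
  qed
  then show ?thesis using aff by simp
qed

section \<open>Hyperplanes and separation\<close>

text \<open>The graphs of these functions are the nonvertical hyperplanes.\<close>

definition graph_fun :: "nat \<Rightarrow> (point \<Rightarrow> real) \<Rightarrow> bool" where
  "graph_fun d m \<longleftrightarrow> (\<exists>c f. linear f \<and> f (unit_vec (d - 1)) = 0 \<and> m = (\<lambda>x. c + f x))"

text \<open>For subsets of \<open>coord_space d\<close> with \<open>d\<close> at least 1 this says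
  that the projections of any \<open>d\<close> points are affinely independent. The values
  \<open>v\<close> are free because both heights and indicator-like values get interpolated.\<close>

definition interpolating :: "nat \<Rightarrow> point set \<Rightarrow> bool" where
  "interpolating d A \<longleftrightarrow>
     (\<forall>T v. T \<subseteq> A \<and> card T = d \<longrightarrow> (\<exists>m. graph_fun d m \<and> (\<forall>t\<in>T. m t = v t)))"

lemma interpolating_mono: "interpolating d A \<Longrightarrow> A' \<subseteq> A \<Longrightarrow> interpolating d A'"
  unfolding interpolating_def by blast

text \<open>The case \<open>i = d - 1\<close> of strong general position says that the hyperplane
  through \<open>T\<close> is not vertical. Hence the differences to a base point \<open>a\<close>
  stay independent when the vertical axis is added, and a functional can be prescribed on all of
  them.\<close>

lemma strongly_general_position_interpolating:
  assumes sgp: "strongly_general_position d S" and d: "2 \<le> d"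
  shows "interpolating d S"
  unfolding interpolating_def
proof (intro allI impI)
  fix T :: "point set" and v :: "point \<Rightarrow> real"
  assume T: "T \<subseteq> S \<and> card T = d"
  have gp: "general_position d S" using sgp by (simp add: strongly_general_position_def)
  have hyp: "affine_subspace d (d - 1) (affine hull T)"
    using general_position_hyperplane[OF gp d] T by blast
  have fin: "finite T" using T d by (intro card_ge_0_finite) simp
  from T d obtain a where a: "a \<in> T" by fastforce
  let ?V = "(\<lambda>x. x - a) ` (T - {a})"
  have dir: "direction (affine hull T) = span ?V" by (rule direction_affine_hull[OF a])
  have cV: "card ?V = d - 1"
    using a fin T by (subst card_image) (auto simp: inj_on_def)
  have dimV: "dim ?V = d - 1" using hyp by (simp add: affine_subspace_def dir)
  obtain B where B: "B \<subseteq> ?V" "independent B" "?V \<subseteq> span B" "card B = dim ?V"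
    using basis_exists by blast
  then have "B = ?V" using cV dimV fin by (intro card_subset_eq) auto
  then have indV: "independent ?V" using B by simp
  have "\<not> parallel_subspaces (affine hull T) (last_axes_space d (d - (d - 1)))"
    using sgp T hyp d unfolding strongly_general_position_def by force
  moreover have "last_axes_space d (d - (d - 1)) = span {unit_vec (d - 1)}"
  proof -
    have "{unit_vec j | j. d - 1 \<le> j \<and> j < d} = {unit_vec (d - 1)}" using d by (auto intro!: exI[of _ "d - 1"] arg_cong[of _ _ unit_vec])
    then show ?thesis using d by (simp add: last_axes_space_def)
  qed
  ultimately have "\<not> span {unit_vec (d - 1)} \<subseteq> span ?V"
    by (simp add: parallel_subspaces_def dir direction_span)
  then have ax: "unit_vec (d - 1) \<notin> span ?V"
    by (metis empty_subsetI insert_subset span_minimal subspace_span)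
  then have "independent (insert (unit_vec (d - 1)) ?V)"
    using indV by (rule independent_insertI)
  \<comment> \<open>The differences \<open>x = t - a\<close> receive the increments of
    \<open>v\<close> from \<open>a\<close>, and the vertical axis receives 0.\<close>
  then obtain f :: "point \<Rightarrow> real" where f: "linear f"
    "\<forall>x\<in>insert (unit_vec (d - 1)) ?V. f x = (if x = unit_vec (d - 1) then 0 else v (a + x) - v a)"
    using linear_independent_extend[where f = "\<lambda>x. if x = unit_vec (d - 1) then 0 else v (a + x) - v a"] by blast
  let ?m = "\<lambda>x. (v a - f a) + f x"
  have "?m t = v t" if "t \<in> T" for t
  proof (cases "t = a")
    case False
    then have "t - a \<in> ?V" using that by blast
    moreover from this have "t - a \<noteq> unit_vec (d - 1)" using ax span_base by metis
    ultimately have "f (t - a) = v t - v a" using f(2) by (metis add_diff_cancel_left' diff_add_cancel add.commute insertI2)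
    then show ?thesis by (simp add: linear_diff[OF f(1)])
  qed simp
  moreover have "graph_fun d ?m" unfolding graph_fun_def using f(1,2) by (intro exI conjI) auto
  ultimately show "\<exists>m. graph_fun d m \<and> (\<forall>t\<in>T. m t = v t)" by blast
qed

text \<open>This is the case \<open>i = 1\<close>: two points with equal first coordinate span a
  line parallel to the space of the last \<open>d - 1\<close> axes.\<close>

lemma strongly_general_position_inj_first:
  assumes sgp: "strongly_general_position d S" and d: "2 \<le> d"
  shows "inj_on (coord 0) S"
proof (rule inj_onI, rule ccontr)
  fix x y assume xy: "x \<in> S" "y \<in> S" "coord 0 x = coord 0 y" "x \<noteq> y"
  have S: "S \<subseteq> coord_space d"
    using sgp by (simp add: strongly_general_position_def general_position_def)
  have dir: "direction (affine hull {x, y}) = span {y - x}"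
    using direction_affine_hull[of x "{x, y}"] xy by (simp add: insert_Diff_if)
  have "independent {y - x}" using xy by (simp add: dependent_single)
  then have "dim (direction (affine hull {x, y})) = 1"
    unfolding dir by (subst dim_span_eq_card_independent) auto
  then have aff: "affine_subspace d 1 (affine hull {x, y})"
    using affine_hull_subset_coord_space[of "{x, y}" d] S xy
    by (auto simp: affine_subspace_def)
  have "y - x \<in> last_axes_space d (d - 1)"
  proof -
    have "y - x = (\<Sum>i\<in>{1..<d}. coord i (y - x) *\<^sub>R unit_vec i)"
    proof (rule poly_mapping_eqI)
      fix k
      have "coord k (y - x) = 0" if "k = 0 \<or> d \<le> k"
        using that xy S by (auto simp: lookup_minus mem_coord_space subset_iff)
      then have "(\<Sum>i\<in>{1..<d}. (if k = i then coord i (y - x) else 0)) = coord k (y - x)"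
        by (subst sum.delta') (auto simp: not_less)
      moreover have "coord k (\<Sum>i\<in>{1..<d}. coord i (y - x) *\<^sub>R unit_vec i)
          = (\<Sum>i\<in>{1..<d}. (if k = i then coord i (y - x) else 0))"
        unfolding lookup_sum coord_scaleR lookup_single by (intro sum.cong) (auto simp: when_def)
      ultimately show "coord k (y - x) = coord k (\<Sum>i\<in>{1..<d}. coord i (y - x) *\<^sub>R unit_vec i)"
        by simp
    qed
    moreover have "\<dots> \<in> last_axes_space d (d - 1)"
      unfolding last_axes_space_def using d
      by (intro span_sum span_scale span_base) auto
    ultimately show ?thesis by simp
  qed
  then have "parallel_subspaces (affine hull {x, y}) (last_axes_space d (d - 1))"
    unfolding parallel_subspaces_def dir last_axes_space_def direction_span
    by (intro disjI1 span_minimal subspace_span) auto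
  then have "\<exists>T\<subseteq>S. card T = 1 + 1 \<and> affine_subspace d 1 (affine hull T) \<and>
      parallel_subspaces (affine hull T) (last_axes_space d (d - 1))"
    using xy aff by (intro exI[of _ "{x, y}"]) auto
  moreover have "1 \<in> {1..d - 1}" using d by auto
  ultimately show False using sgp unfolding strongly_general_position_def by blast
qed


lemma graph_fun_const: "graph_fun d (\<lambda>x. c)"
  unfolding graph_fun_def by (rule exI[of _ c], rule exI[of _ "\<lambda>x. 0"]) (simp add: linear_zero)

lemma graph_fun_add_scale:
  assumes "graph_fun d m" "graph_fun d m'"
  shows "graph_fun d (\<lambda>x. m x + r * m' x)"
proof -
  obtain c f where f: "linear f" "f (unit_vec (d - 1)) = 0" "m = (\<lambda>x. c + f x)"
    using assms(1) unfolding graph_fun_def by blast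
  obtain c' f' where f': "linear f'" "f' (unit_vec (d - 1)) = 0" "m' = (\<lambda>x. c' + f' x)"
    using assms(2) unfolding graph_fun_def by blast
  have "linear (\<lambda>x. f x + r *\<^sub>R f' x)"
    using f(1) f'(1) by (intro linear_compose_add linear_compose_scale_right)
  then show ?thesis
    unfolding graph_fun_def using f f'
    by (intro exI[of _ "c + r * c'"] exI[of _ "\<lambda>x. f x + r *\<^sub>R f' x"]) (auto simp: algebra_simps)
qed

lemma graph_fun_uminus: "graph_fun d m \<Longrightarrow> graph_fun d (\<lambda>x. - m x)"
  using graph_fun_add_scale[OF graph_fun_const[of d 0], of m "-1"] by simp

text \<open>As in the simplex method, a hyperplane lying above \<open>E\<close> is rotated, keeping the points
  of \<open>T0\<close> on it, until it touches a further point.\<close>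

lemma slide_hyperplane:
  assumes A: "interpolating d A" "finite A" "d \<le> card A" and E: "E \<subseteq> A"
    and "T0 \<subseteq> A" "card T0 \<le> d" "graph_fun d m" "\<forall>e\<in>E. z e \<le> m e" "\<forall>t\<in>T0. z t = m t"
  shows "\<exists>T m'. T0 \<subseteq> T \<and> T \<subseteq> A \<and> card T = d \<and> graph_fun d m' \<and>
           (\<forall>e\<in>E. z e \<le> m' e) \<and> (\<forall>t\<in>T. z t = m' t)"
  using assms(5-)
proof (induction "d - card T0" arbitrary: T0 m rule: less_induct)
  case less
  have fin: "finite T0" using less.prems(1) A(2) by (rule finite_subset)
  consider "card T0 = d" | "card T0 < d" "E \<subseteq> T0" | e where "card T0 < d" "e \<in> E" "e \<notin> T0"
    using less.prems(2) by force
  then show ?case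
  proof cases
    case 1
    then show ?thesis using less.prems by blast
  next
    case 2
    \<comment> \<open>No point of \<open>E\<close> is left to touch, so any \<open>d\<close> points
      containing \<open>T0\<close> serve; the bound on \<open>E\<close> is then an equality.\<close>
    obtain T where T: "T0 \<subseteq> T" "T \<subseteq> A" "card T = d"
      using exists_subset_between[of T0 d A] less.prems A by auto
    obtain m' where "graph_fun d m'" "\<forall>t\<in>T. m' t = z t"
      using A(1) T unfolding interpolating_def by blast
    then show ?thesis using T 2 by (intro exI[of _ T] exI[of _ m']) auto
  next
    case 3
    have "insert e T0 \<subseteq> A" using 3 less.prems E by auto
    moreover have "card (insert e T0) \<le> d" using 3 fin by simp
    ultimately obtain T where T: "insert e T0 \<subseteq> T" "T \<subseteq> A" "card T = d"
      using exists_subset_between[of "insert e T0" d A] A by auto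
    \<comment> \<open>Adding positive multiples of \<open>h\<close> lowers the hyperplane at
      \<open>e\<close> and does not move it over \<open>T0\<close>.\<close>
    obtain h where h: "graph_fun d h" "\<forall>t\<in>T. h t = (if t = e then - 1 else 0)"
      using A(1)[unfolded interpolating_def, rule_format, of T "\<lambda>t. if t = e then - 1 else 0"] T by blast
    define R where "R = {e'\<in>E. h e' < 0}"
    \<comment> \<open>\<open>q e'\<close> is the multiple of \<open>h\<close> at which the
      hyperplane passes through \<open>e'\<close>. The least such ratio over \<open>R\<close> is the
      largest rotation that stays above \<open>E\<close>; the point attaining it is new, since
      \<open>h\<close> vanishes on \<open>T0\<close>.\<close>
    define q where "q = (\<lambda>e'. (m e' - z e') / (- h e'))"
    have R: "finite R" "e \<in> R"
      using 3 h T A(2) E finite_subset[of E A] by (auto simp: R_def)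
    define r where "r = Min (q ` R)"
    have "r \<in> q ` R" unfolding r_def using R by (intro Min_in) auto
    then obtain e' where e': "e' \<in> R" "q e' = r" by blast
    have rle: "r \<le> q g" if "g \<in> R" for g using that R by (simp add: r_def)
    have r0: "0 \<le> r"
      using e' less.prems(4) by (auto simp: q_def R_def intro!: divide_nonneg_neg)
    let ?m = "\<lambda>x. m x + r * h x"
    have h0: "h t = 0" if "t \<in> T0" for t using that h T 3 by auto
    have "e' \<notin> T0" using h0 e' by (auto simp: R_def)
    have le: "\<forall>g\<in>E. z g \<le> ?m g"
    proof
      fix g assume g: "g \<in> E"
      show "z g \<le> ?m g"
      proof (cases "h g < 0")
        case True
        then have "r \<le> (m g - z g) / (- h g)" using rle[of g] g by (simp add: R_def q_def)
        then show ?thesis using True by (simp add: pos_le_divide_eq field_simps)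
      next
        case False
        then have "0 \<le> r * h g" using r0 by simp
        then show ?thesis using less.prems(4) g by force
      qed
    qed
    have "?m e' = z e'" using e' by (auto simp: q_def R_def field_simps)
    then have eq: "\<forall>t\<in>insert e' T0. z t = ?m t" using h0 less.prems(5) by auto
    have "\<exists>T m'. insert e' T0 \<subseteq> T \<and> T \<subseteq> A \<and> card T = d \<and> graph_fun d m' \<and>
           (\<forall>e\<in>E. z e \<le> m' e) \<and> (\<forall>t\<in>T. z t = m' t)"
    proof (rule less.hyps)
      show "d - card (insert e' T0) < d - card T0" using 3 fin \<open>e' \<notin> T0\<close> by simp
      show "insert e' T0 \<subseteq> A" using less.prems(1) e' E by (auto simp: R_def)
      show "card (insert e' T0) \<le> d" using 3 fin by (simp add: card_insert_if)
      show "graph_fun d ?m" using less.prems(3) h(1) by (rule graph_fun_add_scale)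
    qed (use le eq in auto)
    then show ?thesis by blast
  qed
qed

section \<open>Separating functionals and small perturbations\<close>

definition sep :: "point \<Rightarrow> point set \<Rightarrow> bool" where
  "sep x G \<longleftrightarrow> (\<exists>f :: point \<Rightarrow> real. linear f \<and> (\<forall>g\<in>G. f g < f x))"

text \<open>With \<open>s = 1\<close> or \<open>s = - 1\<close> prescribed on the vertical axis, the
  hyperplane \<open>f = f x\<close> is a graph over the first \<open>d - 1\<close> coordinates, and
  \<open>G\<close> lies strictly below it (\<open>s = 1\<close>) or strictly above it
  (\<open>s = - 1\<close>).\<close>

definition sep_slope :: "nat \<Rightarrow> real \<Rightarrow> point \<Rightarrow> point set \<Rightarrow> bool" where
  "sep_slope d s x G \<longleftrightarrow>
     (\<exists>f :: point \<Rightarrow> real. linear f \<and> f (unit_vec (d - 1)) = s \<and> (\<forall>g\<in>G. f g < f x))"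

lemma sep_not_in_hull:
  assumes "sep x G" shows "x \<notin> convex hull G"
proof
  assume x: "x \<in> convex hull G"
  obtain f :: "point \<Rightarrow> real" where f: "linear f" "\<forall>g\<in>G. f g < f x"
    using assms unfolding sep_def by blast
  have "convex {y. f y < f x}"
    using convex_linear_vimage[OF f(1) convex_real_interval(4), of "f x"] by (simp add: vimage_def lessThan_def)
  then have "convex hull G \<subseteq> {y. f y < f x}" using f(2) by (intro hull_minimal) auto
  then show False using x by auto
qed

text \<open>\<open>B\<close> lies below (\<open>s = 1\<close>) or above (\<open>s = - 1\<close>) every hyperplane through \<open>d\<close> points of \<open>A\<close>.\<close>

definition beyond :: "nat \<Rightarrow> real \<Rightarrow> point set \<Rightarrow> point set \<Rightarrow> bool" where
  "beyond d s A B \<longleftrightarrow>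
     (\<forall>T m. T \<subseteq> A \<and> card T = d \<and> graph_fun d m \<and> (\<forall>t\<in>T. s * coord (d - 1) t = m t) \<longrightarrow>
        (\<forall>b\<in>B. s * coord (d - 1) b < m b))"

lemma linear_eq_const_on_affine_hull:
  fixes f :: "point \<Rightarrow> real"
  assumes f: "linear f" "\<forall>t\<in>T. f t = c" and "y \<in> affine hull T"
  shows "f y = c"
proof -
  have "affine {y. f y = c}"
    unfolding affine_def
    by (auto simp: linear_add[OF f(1)] linear_scale[OF f(1)] distrib_right[symmetric])
  then have "affine hull T \<subseteq> {y. f y = c}" using f(2) by (intro hull_minimal) auto
  then show ?thesis using assms(3) by auto
qed

text \<open>Links affine hulls with graphs. With \<open>m = c + f\<close>, the functional
  \<open>s * coord (d - 1) - f\<close> is constant on \<open>T\<close>, hence on its hull, and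
  \<open>f\<close> takes equal values at the vertically aligned \<open>x\<close> and
  \<open>y\<close>.\<close>

lemma height_on_hyperplane:
  assumes T: "T \<subseteq> coord_space d" and d: "1 \<le> d" and m: "graph_fun d m"
    and "\<forall>t\<in>T. s * coord (d - 1) t = m t" and y: "y \<in> affine hull T"
    and x: "x \<in> coord_space d" "first_coords (d - 1) y = first_coords (d - 1) x"
  shows "s * coord (d - 1) y = m x"
proof -
  obtain c f where f: "linear f" "f (unit_vec (d - 1)) = 0" "m = (\<lambda>x. c + f x)"
    using m unfolding graph_fun_def by blast
  have "linear (\<lambda>w. s *\<^sub>R coord (d - 1) w - f w)"
    using f(1) by (intro linear_compose_sub linear_compose_scale_right linear_coord)
  then have "s *\<^sub>R coord (d - 1) y - f y = c"
    by (rule linear_eq_const_on_affine_hull[OF _ _ y]) (use assms f in auto)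
  moreover have "f y = f x"
    by (rule linear_eq_if_first_coords_eq[OF f(1,2) _ x(1) d x(2)])
      (use y affine_hull_subset_coord_space[OF T] in blast)
  ultimately show ?thesis using f(3) by simp
qed

text \<open>By general position any \<open>d\<close> points of \<open>A\<close> determine a
  hyperplane, which is then also determined by the larger set witnessing \<open>deep_below\<close>.
  The sign \<open>- 1\<close> reflects the heights, so that lying above becomes an upper bound as
  well.\<close>

lemma deep_below_imp_beyond:
  assumes sgp: "strongly_general_position d H" and d: "2 \<le> d"
    and sub: "A \<subseteq> H" "B \<subseteq> H" and deep: "deep_below d B A"
  shows "beyond d 1 A B" "beyond d (-1) B A"
proof -
  have gp: "general_position d H" and H: "H \<subseteq> coord_space d"
    using sgp by (auto simp: strongly_general_position_def general_position_def)
  obtain A' B' where *: "A \<subseteq> A'" "B \<subseteq> B'" "deep_below_large d B' A'"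
    using deep unfolding deep_below_def by blast
  have det: "affine hull T \<in> determined_hyperplanes d C"
    if "T \<subseteq> C'" "C' \<subseteq> C" "C' \<subseteq> H" "card T = d" for T C C'
    unfolding determined_hyperplanes_def
    using that general_position_hyperplane[OF gp d, of T] by blast
  show "beyond d 1 A B"
    unfolding beyond_def
  proof (intro allI impI ballI)
    fix T m b
    assume T: "T \<subseteq> A \<and> card T = d \<and> graph_fun d m \<and> (\<forall>t\<in>T. 1 * coord (d - 1) t = m t)" and b: "b \<in> B"
    then have "lies_below d b (affine hull T)"
      using * det[of T A A'] sub unfolding deep_below_large_def by blast
    then obtain y where y: "y \<in> affine hull T" "first_coords (d - 1) y = first_coords (d - 1) b"
      "coord (d - 1) b < coord (d - 1) y"
      unfolding lies_below_def by blast
    have "1 * coord (d - 1) y = m b"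
      by (rule height_on_hyperplane[where T = T]) (use T H sub b y d in auto)
    then show "1 * coord (d - 1) b < m b" using y(3) by simp
  qed
  show "beyond d (-1) B A"
    unfolding beyond_def
  proof (intro allI impI ballI)
    fix T m a
    assume T: "T \<subseteq> B \<and> card T = d \<and> graph_fun d m \<and> (\<forall>t\<in>T. - 1 * coord (d - 1) t = m t)" and a: "a \<in> A"
    then have "lies_above d a (affine hull T)"
      using * det[of T B B'] sub unfolding deep_below_large_def by blast
    then obtain y where y: "y \<in> affine hull T" "first_coords (d - 1) y = first_coords (d - 1) a"
      "coord (d - 1) y < coord (d - 1) a"
      unfolding lies_above_def by blast
    have "- 1 * coord (d - 1) y = m a"
      by (rule height_on_hyperplane[where T = T]) (use T H sub a y d in auto)
    then show "- 1 * coord (d - 1) a < m a" using y(3) by simp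
  qed
qed

text \<open>Makes perturbations precise: finitely many strict inequalities survive a small multiple
  of any function.\<close>

lemma exists_small_multiplier:
  fixes g h :: "'a \<Rightarrow> real"
  assumes "finite F" "\<forall>x\<in>F. 0 < g x"
  shows "\<exists>\<epsilon>>0. \<forall>x\<in>F. \<epsilon> * h x < g x"
  using assms
proof (induction F rule: finite_induct)
  case empty
  show ?case by (intro exI[of _ 1]) simp
next
  case (insert x F)
  then obtain \<epsilon> where e: "\<epsilon> > 0" "\<forall>x\<in>F. \<epsilon> * h x < g x" by auto
  \<comment> \<open>The summand 1 avoids division by zero and makes the inequality at
    \<open>x\<close> strict.\<close>
  define \<delta> where "\<delta> = min \<epsilon> (g x / (\<bar>h x\<bar> + 1))"
  have gx: "0 < g x" using insert.prems by simp
  then have d: "0 < \<delta>" "\<delta> \<le> \<epsilon>" "\<delta> \<le> g x / (\<bar>h x\<bar> + 1)"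
    using e by (auto simp: \<delta>_def intro!: divide_pos_pos)
  have "\<delta> * h y < g y" if "y \<in> F" for y
  proof (cases "0 \<le> h y")
    case True
    then have "\<delta> * h y \<le> \<epsilon> * h y" using d by (intro mult_right_mono) auto
    then show ?thesis using e that by force
  next
    case False
    then have "\<delta> * h y < 0" using d by (simp add: mult_pos_neg)
    then show ?thesis using insert.prems that by force
  qed
  moreover have "\<delta> * h x < g x"
  proof -
    have "\<delta> * h x < \<delta> * (\<bar>h x\<bar> + 1)" using d by (intro mult_strict_left_mono) auto
    also have "\<dots> \<le> g x" using d(3) by (simp add: pos_le_divide_eq)
    finally show ?thesis .
  qed
  ultimately show ?case using d by (intro exI[of _ \<delta>]) auto
qed

text \<open>The rotation argument for both signs at once: \<open>s = 1\<close> serves the upper set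
  and \<open>s = - 1\<close> the lower one.\<close>

lemma sep_beyond_union:
  assumes A: "interpolating d A" "finite A" "d \<le> card A" and d: "1 \<le> d"
    and x: "x \<in> A" and E: "E \<subseteq> A" "sep_slope d s x E"
    and F: "beyond d s A F" "finite F"
  shows "sep x (E \<union> F)"
proof -
  let ?z = "\<lambda>y. s * coord (d - 1) y"
  obtain f :: "point \<Rightarrow> real" where f: "linear f" "f (unit_vec (d - 1)) = s" "\<forall>g\<in>E. f g < f x"
    using E(2) unfolding sep_slope_def by blast
  have "linear (\<lambda>y. s *\<^sub>R coord (d - 1) y - f y)"
    using f(1) by (intro linear_compose_sub linear_compose_scale_right linear_coord)
  \<comment> \<open>This is the hyperplane \<open>f = f x\<close> as a graph in heights scaled by
    \<open>s\<close>. It contains \<open>x\<close> and is rotated with \<open>x\<close> kept on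
    it.\<close>
  then have "graph_fun d (\<lambda>y. f x + (s *\<^sub>R coord (d - 1) y - f y))"
    unfolding graph_fun_def using f(2) by (intro exI conjI) (auto simp: lookup_single)
  then obtain T m where T: "{x} \<subseteq> T" "T \<subseteq> A" "card T = d" "graph_fun d m"
    "\<forall>e\<in>E. ?z e \<le> m e" "\<forall>t\<in>T. ?z t = m t"
    using slide_hyperplane[OF A E(1), of "{x}" "\<lambda>y. f x + (s *\<^sub>R coord (d - 1) y - f y)" ?z] x d f(3)
    by fastforce
  obtain c h where h: "linear h" "m = (\<lambda>y. c + h y)"
    using T(4) unfolding graph_fun_def by blast
  have Fz: "\<forall>b\<in>F. 0 < m b - ?z b" using F(1) T unfolding beyond_def by fastforce
  then obtain \<epsilon> where e: "\<epsilon> > 0" "\<forall>b\<in>F. \<epsilon> * (f b - f x) < m b - ?z b"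
    using exists_small_multiplier[OF F(2) Fz, of "\<lambda>b. f b - f x"] by blast
  \<comment> \<open>The first part equals \<open>c\<close> at \<open>x\<close>, is at most
    \<open>c\<close> on \<open>E\<close> and less than \<open>c\<close> on \<open>F\<close>. The
    term with \<open>f\<close> breaks the ties on \<open>E\<close>, and \<open>\<epsilon>\<close> is
    too small to spoil the gap on \<open>F\<close>.\<close>
  let ?L = "\<lambda>y. (s *\<^sub>R coord (d - 1) y - h y) + \<epsilon> *\<^sub>R f y"
  have lin: "linear ?L"
    using f(1) h(1) by (intro linear_compose_add linear_compose_sub linear_compose_scale_right linear_coord)
  have Lx: "?L x = c + \<epsilon> * f x" using T(1,6) h(2) by auto
  have "?L g < ?L x" if "g \<in> E \<union> F" for g
  proof (cases "g \<in> E")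
    case True
    then have "\<epsilon> * f g < \<epsilon> * f x" using f(3) e(1) by simp
    moreover have "?z g - h g \<le> c" using True T(5) h(2) by fastforce
    ultimately show ?thesis unfolding Lx by simp
  next
    case False
    then have "\<epsilon> * (f g - f x) < m g - ?z g" using that e(2) by blast
    then show ?thesis unfolding Lx using h(2) by (simp add: algebra_simps)
  qed
  then show ?thesis unfolding sep_def using lin by (intro exI[of _ ?L]) auto
qed

text \<open>A hyperplane through \<open>d\<close> points of \<open>G\<close> with \<open>D\<close>
  on one side has \<open>x\<close> strictly on the other side. It is found by sliding from a
  constant bound; heights are negated because \<open>D\<close> has to lie opposite to
  \<open>x\<close>.\<close>

lemma sep_beyond:
  assumes G: "interpolating d G" "finite G" "d \<le> card G" and D: "D \<subseteq> G"
    and x: "beyond d s G {x}"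
  shows "sep x D"
proof -
  let ?z = "\<lambda>y. - (s * coord (d - 1) y)"
  have fin: "finite D" using D G(2) by (rule finite_subset)
  have "\<forall>e\<in>D. ?z e \<le> (\<Sum>y\<in>D. \<bar>?z y\<bar>)"
  proof
    fix e assume "e \<in> D"
    then have "\<bar>?z e\<bar> \<le> (\<Sum>y\<in>D. \<bar>?z y\<bar>)"
      using fin by (intro member_le_sum) auto
    then show "?z e \<le> (\<Sum>y\<in>D. \<bar>?z y\<bar>)" by linarith
  qed
  then obtain T m where T: "T \<subseteq> G" "card T = d" "graph_fun d m"
    "\<forall>e\<in>D. ?z e \<le> m e" "\<forall>t\<in>T. ?z t = m t"
    using slide_hyperplane[OF G D, of "{}" "\<lambda>_. \<Sum>y\<in>D. \<bar>?z y\<bar>" ?z] graph_fun_const by auto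
  have "\<forall>t\<in>T. s * coord (d - 1) t = - m t" using T(5) by fastforce
  then have xm: "s * coord (d - 1) x < - m x"
    using x T graph_fun_uminus[OF T(3)] unfolding beyond_def by blast
  obtain c h where h: "linear h" "m = (\<lambda>y. c + h y)"
    using T(3) unfolding graph_fun_def by blast
  let ?L = "\<lambda>y. (- s) *\<^sub>R coord (d - 1) y - h y"
  have "linear ?L"
    using h(1) by (intro linear_compose_sub linear_compose_scale_right linear_coord)
  moreover have "?L g < ?L x" if "g \<in> D" for g
    using that T(4) xm h(2) by fastforce
  ultimately show ?thesis unfolding sep_def by (intro exI[of _ ?L]) auto
qed


text \<open>A functional that ignores the height may be tilted by \<open>\<epsilon> * s\<close>
  without losing strictness on a finite set. Dividing by \<open>\<epsilon>\<close> then makes the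
  slope exactly \<open>s\<close>.\<close>

lemma sep_slope_if_linear:
  fixes f :: "point \<Rightarrow> real"
  assumes f: "linear f" "f (unit_vec (d - 1)) = 0" "\<forall>g\<in>G. f g < f x" and G: "finite G"
  shows "sep_slope d s x G"
proof -
  have "\<forall>g\<in>G. 0 < f x - f g" using f(3) by simp
  from exists_small_multiplier[OF G this, of "\<lambda>g. s * coord (d - 1) g - s * coord (d - 1) x"]
  obtain \<epsilon> where e: "\<epsilon> > 0" "\<forall>g\<in>G. \<epsilon> * (s * coord (d - 1) g - s * coord (d - 1) x) < f x - f g"
    by blast
  let ?L = "\<lambda>y. s *\<^sub>R coord (d - 1) y + (1 / \<epsilon>) *\<^sub>R f y"
  have "linear ?L"
    using f(1) by (intro linear_compose_add linear_compose_scale_right linear_coord)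
  moreover have "?L (unit_vec (d - 1)) = s" using f(2) by (simp add: lookup_single)
  moreover have "?L g < ?L x" if "g \<in> G" for g
  proof -
    have "(s * coord (d - 1) g - s * coord (d - 1) x) < (f x - f g) / \<epsilon>"
      using e that by (simp add: pos_less_divide_eq mult.commute)
    then show ?thesis by (simp add: diff_divide_distrib)
  qed
  ultimately show ?thesis unfolding sep_slope_def by (intro exI[of _ ?L]) auto
qed

section \<open>Residue classes\<close>

lemma point_index_less:
  assumes "finite Q" "x \<in> Q" "coord 0 x < coord 0 y"
  shows "point_index Q x < point_index Q y"
  unfolding point_index_def using assms by (intro psubset_card_mono) auto

lemma point_index_less_iff:
  assumes "finite Q" "x \<in> Q" "y \<in> Q"
  shows "point_index Q x < point_index Q y \<longleftrightarrow> coord 0 x < coord 0 y"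
proof -
  have "point_index Q x = point_index Q y" if "coord 0 x = coord 0 y"
    using that by (simp add: point_index_def)
  then show ?thesis
    using point_index_less[of Q x y] point_index_less[of Q y x] assms
    by (cases "coord 0 x" "coord 0 y" rule: linorder_cases) auto
qed

lemma bij_betw_point_index:
  assumes "finite Q" "inj_on (coord 0) Q"
  shows "bij_betw (point_index Q) Q {..<card Q}"
proof -
  have inj: "inj_on (point_index Q) Q"
    using assms point_index_less_iff[OF assms(1)]
    by (intro inj_onI) (metis inj_onD linorder_neqE less_irrefl)
  have "point_index Q x < card Q" if "x \<in> Q" for x
    unfolding point_index_def using assms(1) that by (intro psubset_card_mono) auto
  then have "point_index Q ` Q = {..<card Q}"
    using inj by (intro card_subset_eq) (auto simp: card_image)
  with inj show ?thesis by (simp add: bij_betw_def)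
qed

text \<open>The indices fill \<open>{..<card Q}\<close>, so every \<open>t * p + i\<close> with
  \<open>t < card Q div p\<close> occurs.\<close>

lemma card_residue_part:
  assumes Q: "finite Q" "inj_on (coord 0) Q" and i: "i < p"
  shows "card Q div p \<le> card (residue_part Q i p)"
proof -
  have bij: "bij_betw (point_index Q) Q {..<card Q}" by (rule bij_betw_point_index[OF Q])
  have "{t * p + i | t. t < card Q div p} \<subseteq> point_index Q ` residue_part Q i p"
  proof safe
    fix t assume t: "t < card Q div p"
    have "t * p + i < Suc t * p" using i by simp
    also have "\<dots> \<le> card Q" using t by (metis Suc_leI div_times_less_eq_dividend le_trans mult_le_mono1)
    finally obtain q where "q \<in> Q" "point_index Q q = t * p + i"
      using bij unfolding bij_betw_def by (metis imageE lessThan_iff)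
    then show "t * p + i \<in> point_index Q ` residue_part Q i p"
      using i by (intro image_eqI[of _ _ q]) (auto simp: residue_part_def)
  qed
  moreover have "finite (residue_part Q i p)" using Q by (simp add: residue_part_def)
  ultimately have "card {t * p + i | t. t < card Q div p} \<le> card (residue_part Q i p)"
    by (meson card_image_le card_mono finite_imageI le_trans)
  moreover have "card {t * p + i | t. t < card Q div p} = card Q div p"
  proof -
    have "{t * p + i | t. t < card Q div p} = (\<lambda>t. t * p + i) ` {..<card Q div p}" by auto
    then show ?thesis using i by (simp add: card_image inj_on_def)
  qed
  ultimately show ?thesis by simp
qed

text \<open>Split repeatedly, always continuing in a part with at least two elements, until both
  parts are singletons. Each part discarded on the way is on one side of everything kept, in
  particular of the final pair.\<close>

lemma recursive_splits_closest_pair: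
  fixes R :: "nat set \<Rightarrow> nat set \<Rightarrow> bool"
  assumes mono: "\<And>J K J' K'. R J K \<Longrightarrow> J' \<subseteq> J \<Longrightarrow> K' \<subseteq> K \<Longrightarrow> R J' K'"
    and split: "\<forall>I\<subseteq>X. 2 \<le> card I \<longrightarrow> (\<exists>J\<subseteq>I. J \<noteq> {} \<and> I - J \<noteq> {} \<and> R J (I - J))"
    and "finite X" "I \<subseteq> X" "2 \<le> card I"
  shows "\<exists>i\<in>I. \<exists>j\<in>I. i \<noteq> j \<and> R {j} {i} \<and> (\<forall>l\<in>I - {i, j}. R {l} {i, j} \<or> R {i, j} {l})"
  using assms(4,5)
proof (induction "card I" arbitrary: I rule: less_induct)
  case less
  have fin: "finite I" using less.prems(1) assms(3) by (rule finite_subset)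
  obtain J where J: "J \<subseteq> I" "J \<noteq> {}" "I - J \<noteq> {}" "R J (I - J)"
    using split[rule_format, OF less.prems] by auto
  consider "2 \<le> card J" | "2 \<le> card (I - J)" | "card J < 2" "card (I - J) < 2" by linarith
  then show ?case
  proof cases
    case 1
    have "card J < card I" using J fin by (intro psubset_card_mono) auto
    moreover have "J \<subseteq> X" using J less.prems by blast
    ultimately obtain i j where ij: "i \<in> J" "j \<in> J" "i \<noteq> j" "R {j} {i}"
      "\<forall>l\<in>J - {i, j}. R {l} {i, j} \<or> R {i, j} {l}"
      using less.hyps[of J] 1 by blast
    moreover have "R {i, j} {l}" if "l \<in> I - J" for l using mono[OF J(4)] ij that by auto
    ultimately show ?thesis
      using J(1) by (intro bexI[of _ i] bexI[of _ j]) auto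
  next
    case 2
    have "card (I - J) < card I" using J fin by (intro psubset_card_mono) auto
    moreover have "I - J \<subseteq> X" using less.prems by blast
    ultimately obtain i j where ij: "i \<in> I - J" "j \<in> I - J" "i \<noteq> j" "R {j} {i}"
      "\<forall>l\<in>I - J - {i, j}. R {l} {i, j} \<or> R {i, j} {l}"
      using less.hyps[of "I - J"] 2 by blast
    moreover have "R {l} {i, j}" if "l \<in> J" for l using mono[OF J(4)] ij that by auto
    ultimately show ?thesis by (intro bexI[of _ i] bexI[of _ j]) auto
  next
    case 3
    have "finite J" "finite (I - J)" using fin J(1) by (auto intro: finite_subset)
    then have "card J = 1" "card (I - J) = 1" using 3 J(2,3) by (auto simp: less_2_cases_iff)
    then obtain i j where ij: "J = {j}" "I - J = {i}" by (auto simp: card_1_singleton_iff)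
    then have "I = {i, j}" "i \<noteq> j" using J(1) by auto
    then show ?thesis using J(4) ij by auto
  qed
qed

section \<open>Combining two separated sets\<close>

text \<open>Holes (\<open>b = True\<close>) and islands (\<open>b = False\<close>) are treated at once, with the separating
  functionals made explicit so that no separation theorem is needed.\<close>

definition separated_sets :: "bool \<Rightarrow> point set \<Rightarrow> nat \<Rightarrow> point set set" where
  "separated_sets b S k =
     {I. I \<subseteq> S \<and> card I = k \<and> (\<forall>x\<in>S. b \<or> x \<notin> I \<longrightarrow> sep x (I - {x}))}"

definition slope_separated_sets :: "nat \<Rightarrow> real \<Rightarrow> bool \<Rightarrow> point set \<Rightarrow> nat \<Rightarrow> point set set" where
  "slope_separated_sets d s b S k =
     {I. I \<subseteq> S \<and> card I = k \<and> (\<forall>x\<in>S. b \<or> x \<notin> I \<longrightarrow> sep_slope d s x (I - {x}))}"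

lemma finite_separated_sets: "finite S \<Longrightarrow> finite (separated_sets b S k)"
  by (rule finite_subset[of _ "Pow S"]) (auto simp: separated_sets_def)

lemma finite_slope_separated_sets: "finite S \<Longrightarrow> finite (slope_separated_sets d s b S k)"
  by (rule finite_subset[of _ "Pow S"]) (auto simp: slope_separated_sets_def)

lemma separated_sets_island:
  assumes "I \<in> separated_sets b S k" shows "is_island S k I"
proof -
  have "x \<in> I" if "x \<in> convex hull I" "x \<in> S" for x
  proof (rule ccontr)
    assume "x \<notin> I"
    then have "sep x I" using assms that by (auto simp: separated_sets_def)
    then show False using sep_not_in_hull that by blast
  qed
  then show ?thesis
    using assms hull_subset[of I convex] unfolding is_island_def separated_sets_def by blast
qed

lemma separated_sets_hole:
  assumes "I \<in> separated_sets True S k" shows "is_hole S k I"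
  using assms separated_sets_island[OF assms] sep_not_in_hull
  by (auto simp: is_hole_def convex_position_def separated_sets_def)

text \<open>Points of \<open>A\<close> and of \<open>B\<close> are handled by
  \<open>sep_beyond_union\<close> with opposite signs. Any other point is beyond
  \<open>A \<union> B\<close> as a whole, so \<open>sep_beyond\<close> applies to it.\<close>

lemma separated_sets_union:
  assumes H: "interpolating d H" "finite H" and d: "1 \<le> d"
    and AB: "A \<subseteq> H" "B \<subseteq> H" "A \<inter> B = {}" "d \<le> card A" "d \<le> card B"
    and beyond: "beyond d 1 A B" "beyond d (-1) B A"
    and others: "\<forall>x\<in>H - (A \<union> B). \<exists>s. beyond d s (A \<union> B) {x}"
    and E: "E \<in> slope_separated_sets d 1 b A k"
    and F: "F \<in> slope_separated_sets d (-1) b B l"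
  shows "E \<union> F \<in> separated_sets b H (k + l)"
proof -
  have fin: "finite A" "finite B" using AB(1,2) H(2) by (auto intro: finite_subset)
  have EF: "E \<subseteq> A" "F \<subseteq> B" "card E = k" "card F = l"
    using E F by (auto simp: slope_separated_sets_def)
  have finEF: "finite E" "finite F" using EF(1,2) fin by (auto intro: finite_subset)
  have "sep x (E \<union> F - {x})" if x: "x \<in> H" "b \<or> x \<notin> E \<union> F" for x
  proof -
    consider "x \<in> A" | "x \<in> B" | "x \<in> H - (A \<union> B)" using x by blast
    then show ?thesis
    proof cases
      case 1
      have "sep_slope d 1 x (E - {x})" using E 1 x by (auto simp: slope_separated_sets_def)
      moreover have "beyond d 1 A F" using beyond(1) EF unfolding beyond_def by blast
      ultimately have "sep x ((E - {x}) \<union> F)"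
        using interpolating_mono[OF H(1) AB(1)] fin AB d 1 EF finEF
        by (intro sep_beyond_union[where A = A]) auto
      moreover have "(E - {x}) \<union> F = E \<union> F - {x}" using 1 EF AB by blast
      ultimately show ?thesis by simp
    next
      case 2
      have "sep_slope d (-1) x (F - {x})" using F 2 x by (auto simp: slope_separated_sets_def)
      moreover have "beyond d (-1) B E" using beyond(2) EF unfolding beyond_def by blast
      ultimately have "sep x ((F - {x}) \<union> E)"
        using interpolating_mono[OF H(1) AB(2)] fin AB d 2 EF finEF
        by (intro sep_beyond_union[where A = B]) auto
      moreover have "(F - {x}) \<union> E = E \<union> F - {x}" using 2 EF AB by blast
      ultimately show ?thesis by simp
    next
      case 3
      then obtain s where s: "beyond d s (A \<union> B) {x}" using others by blast
      have "d \<le> card (A \<union> B)" using AB(4) fin by (meson card_mono finite_UnI le_trans sup_ge1)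
      moreover have "interpolating d (A \<union> B)" using interpolating_mono[OF H(1)] AB by blast
      ultimately show ?thesis using s fin EF by (intro sep_beyond[where G = "A \<union> B"]) auto
    qed
  qed
  moreover have "card (E \<union> F) = k + l"
    using EF AB finEF by (subst card_Un_disjoint) auto
  ultimately show ?thesis using EF(1,2) AB(1,2) unfolding separated_sets_def by blast
qed

lemma card_separated_sets_ge_prod:
  assumes H: "interpolating d H" "finite H" and d: "1 \<le> d"
    and AB: "A \<subseteq> H" "B \<subseteq> H" "A \<inter> B = {}" "d \<le> card A" "d \<le> card B"
    and "beyond d 1 A B" "beyond d (-1) B A"
    and "\<forall>x\<in>H - (A \<union> B). \<exists>s. beyond d s (A \<union> B) {x}"
  shows "card (slope_separated_sets d 1 b A k) * card (slope_separated_sets d (-1) b B l)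
           \<le> card (separated_sets b H (k + l))"
proof -
  let ?P = "slope_separated_sets d 1 b A k \<times> slope_separated_sets d (-1) b B l"
  have "(\<lambda>(E, F). E \<union> F) ` ?P \<subseteq> separated_sets b H (k + l)"
    using separated_sets_union[OF assms] by auto
  moreover have "inj_on (\<lambda>(E, F). E \<union> F) ?P"
  proof (rule inj_onI, clarify)
    fix E F E' F'
    assume *: "E \<in> slope_separated_sets d 1 b A k" "F \<in> slope_separated_sets d (-1) b B l"
      "E' \<in> slope_separated_sets d 1 b A k" "F' \<in> slope_separated_sets d (-1) b B l"
      and eq: "E \<union> F = E' \<union> F'"
    then have "E \<subseteq> A" "E' \<subseteq> A" "F \<subseteq> B" "F' \<subseteq> B" by (auto simp: slope_separated_sets_def)
    then show "E = E' \<and> F = F'" using eq AB(3) by blast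
  qed
  ultimately have "card ?P \<le> card (separated_sets b H (k + l))"
    by (intro card_inj_on_le[where f = "\<lambda>(E, F). E \<union> F"] finite_separated_sets H)
  then show ?thesis by (simp add: card_cartesian_product)
qed

section \<open>Splitting a Horton set into residue classes\<close>

lemma horton_strongly_general_position:
  "horton d H \<Longrightarrow> 2 \<le> d \<Longrightarrow> strongly_general_position d H"
  by (cases rule: horton.cases) auto

lemma horton_finite:
  "horton d H \<Longrightarrow> 2 \<le> d \<Longrightarrow> finite H"
  using horton_strongly_general_position
  by (auto simp: strongly_general_position_def general_position_def)

text \<open>Two points exclude the rule \<open>small\<close>, and \<open>2 \<le> d\<close> excludes
  the rule \<open>line\<close>, so only \<open>split\<close> remains.\<close>

lemma horton_split:
  assumes "horton d H" "2 \<le> d" "2 \<le> card H"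
  shows "2 < d \<Longrightarrow> horton (d - 1) (first_coords (d - 1) ` H)"
    and "\<forall>i<horton_prime d. horton d (residue_part H i (horton_prime d))"
    and "\<forall>I\<subseteq>{..<horton_prime d}. 2 \<le> card I \<longrightarrow>
       (\<exists>J\<subseteq>I. J \<noteq> {} \<and> I - J \<noteq> {} \<and>
          deep_below d (\<Union>j\<in>J. residue_part H j (horton_prime d))
                       (\<Union>i\<in>I - J. residue_part H i (horton_prime d)))"
  using assms by (cases rule: horton.cases; force)+

lemma horton_prime_ge_2: "2 \<le> horton_prime d"
proof -
  have "prime (horton_prime d)"
    unfolding horton_prime_def using enumerate_in_set[OF primes_infinite] by blast
  then show ?thesis by (rule prime_ge_2_nat)
qed

lemma horton_prime_2: "horton_prime 2 = 2"
  unfolding horton_prime_def enumerate.simps diff_self_eq_0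
  by (rule Least_equality) (auto simp: prime_ge_2_nat)

lemma deep_below_mono:
  "deep_below d B A \<Longrightarrow> B' \<subseteq> B \<Longrightarrow> A' \<subseteq> A \<Longrightarrow> deep_below d B' A'"
  unfolding deep_below_def by (meson subset_trans)

lemma residue_part_disjoint:
  "i < p \<Longrightarrow> j < p \<Longrightarrow> i \<noteq> j \<Longrightarrow> residue_part H i p \<inter> residue_part H j p = {}"
  by (auto simp: residue_part_def)

lemma mem_residue_part:
  "x \<in> H \<Longrightarrow> x \<in> residue_part H (point_index H x mod p) p"
  by (simp add: residue_part_def)

text \<open>\<open>A\<close> and \<open>B\<close> are the pair of classes left by the recursive
  splitting. The size assumption gives every class at least \<open>d\<close> points, which the
  rotation of hyperplanes requires.\<close>

lemma horton_product_bound: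
  assumes H: "horton d H" and d: "2 \<le> d" and large: "d * horton_prime d \<le> card H"
  shows "\<exists>A B. horton d A \<and> horton d B \<and>
    card H div horton_prime d \<le> card A \<and> card H div horton_prime d \<le> card B \<and>
    (\<forall>b k l. card (slope_separated_sets d 1 b A k) * card (slope_separated_sets d (-1) b B l)
           \<le> card (separated_sets b H (k + l)))"
proof -
  define p where "p = horton_prime d"
  define C where "C = (\<lambda>i. residue_part H i p)"
  have p: "2 \<le> p" unfolding p_def by (rule horton_prime_ge_2)
  have "2 * 1 \<le> d * p" using d p by (intro mult_le_mono) auto
  then have large2: "2 \<le> card H" using large by (simp add: p_def)
  have sgp: "strongly_general_position d H" by (rule horton_strongly_general_position[OF H d])
  have fin: "finite H" by (rule horton_finite[OF H d])
  define R where "R = (\<lambda>J K. deep_below d (\<Union>j\<in>J. C j) (\<Union>i\<in>K. C i))"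
  have "\<exists>i\<in>{..<p}. \<exists>j\<in>{..<p}. i \<noteq> j \<and> R {j} {i} \<and> (\<forall>l\<in>{..<p} - {i, j}. R {l} {i, j} \<or> R {i, j} {l})"
  proof (rule recursive_splits_closest_pair)
    show "\<forall>I\<subseteq>{..<p}. 2 \<le> card I \<longrightarrow> (\<exists>J\<subseteq>I. J \<noteq> {} \<and> I - J \<noteq> {} \<and> R J (I - J))"
      unfolding R_def C_def p_def by (rule horton_split(3)[OF H d large2])
    show "R J K \<Longrightarrow> J' \<subseteq> J \<Longrightarrow> K' \<subseteq> K \<Longrightarrow> R J' K'" for J K J' K'
      unfolding R_def by (rule deep_below_mono) auto
  qed (use p in auto)
  then obtain i j where ij: "i < p" "j < p" "i \<noteq> j" "R {j} {i}"
    "\<forall>l\<in>{..<p} - {i, j}. R {l} {i, j} \<or> R {i, j} {l}" by blast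
  have sub: "C l \<subseteq> H" for l by (auto simp: C_def residue_part_def)
  have card: "card H div p \<le> card (C l)" if "l < p" for l
    unfolding C_def using fin strongly_general_position_inj_first[OF sgp d] that by (rule card_residue_part)
  have "d \<le> card H div p" using large p by (simp add: p_def less_eq_div_iff_mult_less_eq)
  then have dC: "d \<le> card (C l)" if "l < p" for l using card[OF that] by simp
  have deep: "deep_below d (C j) (C i)" using ij(4) by (simp add: R_def)
  have "\<exists>s. beyond d s (C i \<union> C j) {x}" if x: "x \<in> H - (C i \<union> C j)" for x
  proof -
    \<comment> \<open>The point lies in a third class, and the splitting puts this whole class below
      or above the chosen pair; this fixes the sign \<open>s\<close>.\<close>
    define l where "l = point_index H x mod p"
    have xl: "x \<in> C l" unfolding C_def l_def using x by (intro mem_residue_part) auto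
    have "l < p" unfolding l_def using p by (intro mod_less_divisor) simp
    moreover have "l \<noteq> i" "l \<noteq> j" using x xl by auto
    ultimately consider "R {l} {i, j}" | "R {i, j} {l}" using ij(5) by auto
    then show ?thesis
    proof cases
      case 1
      then have "deep_below d (C l) (C i \<union> C j)" by (simp add: R_def)
      then have "beyond d 1 (C i \<union> C j) (C l)"
        using deep_below_imp_beyond(1)[OF sgp d, of "C i \<union> C j" "C l"] sub by simp
      then show ?thesis using xl unfolding beyond_def by blast
    next
      case 2
      then have "deep_below d (C i \<union> C j) (C l)" by (simp add: R_def)
      then have "beyond d (-1) (C i \<union> C j) (C l)"
        using deep_below_imp_beyond(2)[OF sgp d, of "C l" "C i \<union> C j"] sub by simp
      then show ?thesis using xl unfolding beyond_def by blast
    qed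
  qed
  then have "card (slope_separated_sets d 1 b (C i) k) * card (slope_separated_sets d (-1) b (C j) l)
           \<le> card (separated_sets b H (k + l))" for b k l
    using strongly_general_position_interpolating[OF sgp d] fin d sub dC ij
      deep_below_imp_beyond[OF sgp d sub sub deep] residue_part_disjoint[OF ij(1-3)]
    by (intro card_separated_sets_ge_prod) (auto simp: C_def)
  moreover have "horton d (C i)" "horton d (C j)"
    using horton_split(2)[OF H d large2] ij unfolding C_def p_def by auto
  ultimately show ?thesis using card ij unfolding p_def by blast
qed


section \<open>Counting\<close>

text \<open>The Omega bound with exponent \<open>e\<close>, uniform over all \<open>d\<close>-Horton
  sets.\<close>

definition horton_growth :: "(point set \<Rightarrow> nat) \<Rightarrow> nat \<Rightarrow> nat \<Rightarrow> bool" where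
  "horton_growth F d e \<longleftrightarrow>
     (\<exists>c>0. \<exists>N. \<forall>H. horton d H \<and> N \<le> card H \<longrightarrow> c * real (card H) ^ e \<le> real (F H))"

lemma horton_growthI:
  assumes "c > 0" "\<And>H. horton d H \<Longrightarrow> N \<le> card H \<Longrightarrow> c * real (card H) ^ e \<le> real (F H)"
  shows "horton_growth F d e"
  unfolding horton_growth_def using assms by blast

lemma real_div_nat_ge_half:
  fixes n p :: nat
  assumes "0 < p" "p \<le> n"
  shows "real n / (2 * real p) \<le> real (n div p)"
proof -
  have "n < p * (n div p) + p" using assms(1) by (metis add_strict_left_mono mod_less_divisor mult_div_mod_eq)
  moreover have "1 \<le> n div p" using assms by (simp add: Suc_le_eq div_greater_zero_iff)
  then have "p \<le> p * (n div p)" by simp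
  ultimately have "n \<le> 2 * (p * (n div p))" by linarith
  then have "real n \<le> real (2 * (p * (n div p)))" by (rule of_nat_mono)
  then show ?thesis using assms(1) by (simp add: field_simps)
qed

lemma horton_growth_separated_sets:
  assumes d: "2 \<le> d"
    and A: "horton_growth (\<lambda>A. card (slope_separated_sets d 1 b A k)) d e"
    and B: "horton_growth (\<lambda>B. card (slope_separated_sets d (-1) b B l)) d e'"
  shows "horton_growth (\<lambda>H. card (separated_sets b H (k + l))) d (e + e')"
proof -
  define p where "p = horton_prime d"
  have p: "2 \<le> p" unfolding p_def by (rule horton_prime_ge_2)
  obtain c N where A: "c > 0" "\<And>A. horton d A \<Longrightarrow> N \<le> card A \<Longrightarrow>
      c * real (card A) ^ e \<le> card (slope_separated_sets d 1 b A k)"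
    using A unfolding horton_growth_def by blast
  obtain c' N' where B: "c' > 0" "\<And>B. horton d B \<Longrightarrow> N' \<le> card B \<Longrightarrow>
      c' * real (card B) ^ e' \<le> card (slope_separated_sets d (-1) b B l)"
    using B unfolding horton_growth_def by blast
  \<comment> \<open>With \<open>M * p\<close> points in \<open>H\<close>, each class is large enough
    for the product bound and for both growth hypotheses.\<close>
  define M where "M = max d (max N N')"
  show ?thesis
  proof (rule horton_growthI)
    show "0 < c * c' / (2 * real p) ^ (e + e')" using A(1) B(1) p by simp
    fix H assume H: "horton d H" and large: "M * p \<le> card H"
    have "M \<le> card H div p" using large p by (simp add: less_eq_div_iff_mult_less_eq)
    have le: "l * p \<le> card H" if "l \<le> M" for l
      using large mult_le_mono1[OF that, of p] by linarith
    have "d * horton_prime d \<le> card H" "1 * p \<le> card H"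
      using le[of d] le[of 1] d by (auto simp: M_def p_def)
    then obtain A' B' where AB: "horton d A'" "horton d B'" "card H div p \<le> card A'"
      "card H div p \<le> card B'"
      "card (slope_separated_sets d 1 b A' k) * card (slope_separated_sets d (-1) b B' l)
           \<le> card (separated_sets b H (k + l))"
      using horton_product_bound[OF H d] unfolding p_def by blast
    \<comment> \<open>A lower bound for both class sizes: rounding down in
      \<open>card H div p\<close> costs at most a factor 2. This is the source of the power of
      \<open>2 * p\<close> in the constant.\<close>
    define r where "r = real (card H) / (2 * real p)"
    have r: "r \<le> real (card H div p)" "0 \<le> r"
      unfolding r_def using p \<open>1 * p \<le> card H\<close> by (auto intro!: real_div_nat_ge_half)
    have rA: "r \<le> card A'" "r \<le> card B'" using r(1) AB(3,4) by linarith+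
    have "c * r ^ e \<le> c * real (card A') ^ e"
      using A(1) rA r(2) by (intro mult_left_mono power_mono) auto
    also have "\<dots> \<le> card (slope_separated_sets d 1 b A' k)"
      using A(2)[OF AB(1)] AB(3) \<open>M \<le> card H div p\<close> by (simp add: M_def)
    finally have 1: "c * r ^ e \<le> card (slope_separated_sets d 1 b A' k)" .
    have "c' * r ^ e' \<le> c' * real (card B') ^ e'"
      using B(1) rA r(2) by (intro mult_left_mono power_mono) auto
    also have "\<dots> \<le> card (slope_separated_sets d (-1) b B' l)"
      using B(2)[OF AB(2)] AB(4) \<open>M \<le> card H div p\<close> by (simp add: M_def)
    finally have 2: "c' * r ^ e' \<le> card (slope_separated_sets d (-1) b B' l)" .
    have "c * c' / (2 * real p) ^ (e + e') * real (card H) ^ (e + e') = (c * r ^ e) * (c' * r ^ e')"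
      by (simp add: r_def power_divide power_add)
    also have "\<dots> \<le> real (card (slope_separated_sets d 1 b A' k)) * real (card (slope_separated_sets d (-1) b B' l))"
      using 1 2 B(1) r(2) by (intro mult_mono) auto
    also have "\<dots> \<le> card (separated_sets b H (k + l))"
      using AB(5) by (metis of_nat_mono of_nat_mult)
    finally show "c * c' / (2 * real p) ^ (e + e') * real (card H) ^ (e + e')
      \<le> real (card (separated_sets b H (k + l)))" .
  qed
qed

section \<open>Transfer from the projection\<close>

lemma inj_on_first_coords:
  assumes "inj_on (coord 0) A" "0 < m" shows "inj_on (first_coords m) A"
proof (rule inj_onI)
  fix x y assume "x \<in> A" "y \<in> A" and eq: "first_coords m x = first_coords m y"
  moreover have "coord 0 x = coord 0 y"
    using arg_cong[OF eq, of "coord 0"] assms(2) by (simp add: coord_first_coords)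
  ultimately show "x = y" using assms(1) by (simp add: inj_on_def)
qed

text \<open>Sets are pulled back along the projection, which is injective on \<open>A\<close>. A
  separating functional composed with the projection ignores the height, so any slope
  \<open>s\<close> can be reached.\<close>

lemma card_separated_sets_projection:
  assumes A: "finite A" "inj_on (coord 0) A" and d: "2 \<le> d"
  shows "card (separated_sets b (first_coords (d - 1) ` A) k) \<le> card (slope_separated_sets d s b A k)"
proof -
  let ?\<pi> = "first_coords (d - 1)"
  have inj: "inj_on ?\<pi> A" using A(2) d by (intro inj_on_first_coords) auto
  let ?g = "\<lambda>I. {x \<in> A. ?\<pi> x \<in> I}"
  have im: "?\<pi> ` ?g I = I" if "I \<subseteq> ?\<pi> ` A" for I using that by auto
  have "?g I \<in> slope_separated_sets d s b A k" if I: "I \<in> separated_sets b (?\<pi> ` A) k" for I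
  proof -
    have sub: "I \<subseteq> ?\<pi> ` A" and c: "card I = k" using I by (auto simp: separated_sets_def)
    have "card (?\<pi> ` ?g I) = card (?g I)"
      by (rule card_image) (rule inj_on_subset[OF inj], auto)
    then have "card (?g I) = k" using im[OF sub] c by simp
    moreover have "sep_slope d s x (?g I - {x})" if x: "x \<in> A" "b \<or> x \<notin> ?g I" for x
    proof -
      have "sep (?\<pi> x) (I - {?\<pi> x})" using I x by (auto simp: separated_sets_def)
      then obtain f :: "point \<Rightarrow> real" where f: "linear f" "\<forall>g\<in>I - {?\<pi> x}. f g < f (?\<pi> x)"
        unfolding sep_def by blast
      show ?thesis
      proof (rule sep_slope_if_linear)
        show "linear (\<lambda>y. f (?\<pi> y))"
          using linear_compose[OF linear_first_coords f(1)] by (simp add: o_def)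
        show "f (?\<pi> (unit_vec (d - 1))) = 0" using linear_0[OF f(1)] by (simp add: first_coords_unit_vec)
        show "\<forall>g\<in>?g I - {x}. f (?\<pi> g) < f (?\<pi> x)" using f(2) inj x(1) by (auto dest: inj_onD)
        show "finite (?g I - {x})" using A(1) by simp
      qed
    qed
    ultimately show ?thesis unfolding slope_separated_sets_def by blast
  qed
  moreover have "inj_on ?g (separated_sets b (?\<pi> ` A) k)"
    by (rule inj_on_inverseI[of _ "\<lambda>J. ?\<pi> ` J"]) (use im in \<open>auto simp: separated_sets_def\<close>)
  ultimately show ?thesis
    by (intro card_inj_on_le[where f = ?g] finite_slope_separated_sets A(1)) auto
qed

lemma horton_growth_projection:
  assumes "horton_growth (\<lambda>H. card (separated_sets b H k)) (d - 1) e" and d: "3 \<le> d"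
  shows "horton_growth (\<lambda>A. card (slope_separated_sets d s b A k)) d e"
proof -
  obtain c N where c: "c > 0" "\<And>H. horton (d - 1) H \<Longrightarrow> N \<le> card H \<Longrightarrow>
      c * real (card H) ^ e \<le> card (separated_sets b H k)"
    using assms(1) unfolding horton_growth_def by blast
  show ?thesis
  proof (rule horton_growthI[OF c(1)])
    \<comment> \<open>The 2 makes \<open>horton_split\<close> applicable, which supplies the Horton
      property of the projection.\<close>
    fix A assume A: "horton d A" "max 2 N \<le> card A"
    let ?P = "first_coords (d - 1) ` A"
    have inj: "inj_on (coord 0) A"
      using horton_strongly_general_position[OF A(1)] d by (intro strongly_general_position_inj_first) auto
    have P: "card ?P = card A" using inj_on_first_coords[OF inj] d by (intro card_image) auto
    have "horton (d - 1) ?P" using horton_split(1)[OF A(1)] A(2) d by auto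
    then have "c * real (card ?P) ^ e \<le> card (separated_sets b ?P k)" using c(2)[of ?P] P A(2) by simp
    also have "\<dots> \<le> card (slope_separated_sets d s b A k)"
      using card_separated_sets_projection[OF horton_finite[OF A(1)] inj] d by auto
    finally show "c * real (card A) ^ e \<le> card (slope_separated_sets d s b A k)" using P by simp
  qed
qed

section \<open>The base case in the plane\<close>

lemma planar_horton_beyond:
  assumes H: "horton 2 A" "2 \<le> card A" and s: "s = 1 \<or> s = - 1"
  shows "\<exists>c<2. beyond 2 (- s) (residue_part A (1 - c) 2) (residue_part A c 2)"
proof -
  have "\<exists>J\<subseteq>{..<2}. J \<noteq> {} \<and> {..<2} - J \<noteq> {} \<and>
          deep_below 2 (\<Union>j\<in>J. residue_part A j 2) (\<Union>i\<in>{..<2} - J. residue_part A i 2)"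
    using horton_split(3)[OF H(1) _ H(2)] by (simp add: horton_prime_2)
  then obtain J where J: "J \<subseteq> {..<2::nat}" "J \<noteq> {}" "{..<2} - J \<noteq> {}"
    "deep_below 2 (\<Union>j\<in>J. residue_part A j 2) (\<Union>i\<in>{..<2} - J. residue_part A i 2)" by blast
  have two: "{..<2::nat} = {0, 1}" by auto
  have "J = {0} \<or> J = {1}" using J(1-3) unfolding two by blast
  then obtain j where j: "j < 2" "J = {j}" by auto
  have "{..<2} - {j} = {1 - j}" using j(1) unfolding two by (auto simp: less_2_cases_iff)
  then have deep: "deep_below 2 (residue_part A j 2) (residue_part A (1 - j) 2)"
    using J(4) j by simp
  have sgp: "strongly_general_position 2 A" using H by (intro horton_strongly_general_position) auto
  have sub: "residue_part A i 2 \<subseteq> A" for i by (auto simp: residue_part_def)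
  note bey = deep_below_imp_beyond[OF sgp order_refl sub sub deep]
  show ?thesis
  \<comment> \<open>Class \<open>j\<close> is the lower one. For \<open>s = 1\<close> the wanted
    \<open>c\<close> is the parity of the upper class, for \<open>s = - 1\<close> that of the lower
    class.\<close>
  proof (cases "s = 1")
    case True
    have "1 - (1 - j) = j" using j(1) by auto
    then show ?thesis using bey(2) True by (intro exI[of _ "1 - j"]) auto
  next
    case False
    then show ?thesis using bey(1) s j(1) by (intro exI[of _ j]) auto
  qed
qed

text \<open>The line through \<open>u\<close> and \<open>w\<close> separates: its functional,
  normalised to slope \<open>s\<close>, is constant on both points and larger at
  \<open>y\<close>.\<close>

lemma middle_point_sep_slope:
  assumes sgp: "strongly_general_position 2 A" and AB: "B \<subseteq> A"
    and bey: "beyond 2 (- s) B {y}" and uw: "u \<in> B" "w \<in> B" "u \<noteq> w"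
  shows "sep_slope 2 s y {u, w}"
proof -
  have "{u, w} \<subseteq> A \<and> card {u, w} = 2" using uw AB by auto
  then obtain m where m: "graph_fun 2 m" "\<forall>t\<in>{u, w}. m t = - s * coord 1 t"
    using strongly_general_position_interpolating[OF sgp order_refl, unfolded interpolating_def,
        rule_format, of "{u, w}" "\<lambda>t. - s * coord 1 t"] by blast
  then have lt: "- s * coord 1 y < m y"
    using bey[unfolded beyond_def, rule_format, of "{u, w}" m y] uw by auto
  obtain c h where h: "linear h" "h (unit_vec (2 - 1)) = 0" "m = (\<lambda>x. c + h x)"
    using m(1) unfolding graph_fun_def by blast
  let ?f = "\<lambda>x. s *\<^sub>R coord 1 x + h x"
  have "linear ?f" using h(1) by (intro linear_compose_add linear_compose_scale_right linear_coord)
  moreover have "?f (unit_vec (2 - 1)) = s" using h(2) by (simp add: lookup_single)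
  moreover have "\<forall>g\<in>{u, w}. ?f g < ?f y" using m(2) lt h(3) by auto
  ultimately show ?thesis unfolding sep_slope_def by (intro exI[of _ ?f]) auto
qed

text \<open>The sets are those of \<open>k\<close> consecutive points. For \<open>k = 3\<close> the middle point must lie above
  (\<open>s = 1\<close>) or below (\<open>s = - 1\<close>) the segment of the other two, which fixes its parity.\<close>

lemma horton_growth_plane:
  assumes k: "1 \<le> k" "b \<longrightarrow> k \<le> 3" and s: "s = 1 \<or> s = - 1"
  shows "horton_growth (\<lambda>A. card (slope_separated_sets 2 s b A k)) 2 1"
proof (rule horton_growthI)
  show "(0::real) < 1 / 4" by simp
  fix A assume A: "horton 2 A" "2 * k + 2 \<le> card A"
  let ?n = "card A" and ?i = "point_index A"
  have sgp: "strongly_general_position 2 A" using A by (intro horton_strongly_general_position) auto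
  have fin: "finite A" using A by (intro horton_finite) auto
  have inj: "inj_on (coord 0) A" using strongly_general_position_inj_first[OF sgp] by simp
  have bij: "bij_betw ?i A {..<?n}" by (rule bij_betw_point_index[OF fin inj])
  obtain c where c: "c < 2" "beyond 2 (- s) (residue_part A (1 - c) 2) (residue_part A c 2)"
    using planar_horton_beyond[OF A(1) _ s] A(2) by auto
  \<comment> \<open>Windows start at parity \<open>1 - c\<close>, so the second point of each window
    has parity \<open>c\<close>.\<close>
  define start where "start = (\<lambda>r. 2 * r + (1 - c))"
  define W where "W = (\<lambda>r. {q \<in> A. start r \<le> ?i q \<and> ?i q < start r + k})"
  have fit: "start r + k \<le> ?n" if "r < (?n - k) div 2" for r
    using that A(2) unfolding start_def by linarith
  have img: "?i ` W r = {start r..<start r + k}" if "r < (?n - k) div 2" for r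
  proof -
    have "{start r..<start r + k} \<subseteq> ?i ` A" using fit[OF that] bij by (auto simp: bij_betw_def)
    then show ?thesis unfolding W_def by auto
  qed
  have subW: "W r \<subseteq> A" for r by (auto simp: W_def)
  have cardW: "card (W r) = k" if "r < (?n - k) div 2" for r
  proof -
    have "card (?i ` W r) = card (W r)"
      using bij subW by (intro card_image) (auto simp: bij_betw_def intro: inj_on_subset)
    then show ?thesis using img[OF that] by simp
  qed
  have left: "sep_slope 2 s x G" if "x \<in> A" "G \<subseteq> A" "\<forall>g\<in>G. ?i x < ?i g" for x G
  proof (rule sep_slope_if_linear)
    show "linear (\<lambda>y. - coord 0 y)" by (intro linear_compose_neg linear_coord)
    show "\<forall>g\<in>G. - coord 0 g < - coord 0 x"
      using that point_index_less_iff[OF fin that(1)] by auto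
    show "finite G" using that(2) fin by (rule finite_subset)
  qed (simp add: lookup_single)
  have right: "sep_slope 2 s x G" if "x \<in> A" "G \<subseteq> A" "\<forall>g\<in>G. ?i g < ?i x" for x G
  proof (rule sep_slope_if_linear)
    show "linear (coord 0)" by (rule linear_coord)
    show "\<forall>g\<in>G. coord 0 g < coord 0 x"
      using that point_index_less_iff[OF fin _ that(1)] by auto
    show "finite G" using that(2) fin by (rule finite_subset)
  qed (simp add: lookup_single)
  have "W r \<in> slope_separated_sets 2 s b A k" if r: "r < (?n - k) div 2" for r
  proof -
    have "sep_slope 2 s x (W r - {x})" if x: "x \<in> A" "b \<or> x \<notin> W r" for x
    proof -
      have ne: "?i g \<noteq> ?i x" if "g \<in> W r - {x}" for g
        using that x bij subW by (auto simp: bij_betw_def dest: inj_onD)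
      \<comment> \<open>The first coordinate or its negative separates any \<open>x\<close> not
        strictly inside the window. A point strictly inside belongs to \<open>W r\<close>, so
        \<open>b\<close> holds and \<open>k \<le> 3\<close> makes it the middle of three.\<close>
      consider "?i x \<le> start r" | "start r + k \<le> ?i x + 1" | "start r < ?i x" "?i x + 1 < start r + k"
        by linarith
      then show ?thesis
      proof cases
        case 1
        then show ?thesis using ne subW x by (intro left) (fastforce simp: W_def)+
      next
        case 2
        then show ?thesis using ne subW x by (intro right) (fastforce simp: W_def)+
      next
        case 3
        then have "b" using x by (auto simp: W_def)
        then have k3: "k = 3" "?i x = start r + 1" using k(2) 3 by linarith+
        have "start r \<in> ?i ` W r" "start r + 2 \<in> ?i ` W r" using img[OF r] k3 by auto
        then obtain u w where uw: "u \<in> W r" "?i u = start r" "w \<in> W r" "?i w = start r + 2" by (metis imageE)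
        have "u \<noteq> w" using uw by auto
        have "W r - {x} \<subseteq> {u, w}"
        proof
          fix g assume g: "g \<in> W r - {x}"
          then have "?i g = ?i u \<or> ?i g = ?i w" using ne[OF g] k3 uw by (auto simp: W_def)
          moreover have "g \<in> A" "u \<in> A" "w \<in> A" using g uw subW by auto
          ultimately show "g \<in> {u, w}" using bij by (auto simp: bij_betw_def inj_on_eq_iff)
        qed
        moreover have "sep_slope 2 s x {u, w}"
        proof (rule middle_point_sep_slope[OF sgp])
          show "residue_part A (1 - c) 2 \<subseteq> A" by (auto simp: residue_part_def)
          show "u \<in> residue_part A (1 - c) 2" "w \<in> residue_part A (1 - c) 2"
            using uw subW by (auto simp: residue_part_def start_def)
          have "x \<in> residue_part A c 2"
            using x k3 c(1) by (auto simp: residue_part_def start_def less_2_cases_iff)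
          then show "beyond 2 (- s) (residue_part A (1 - c) 2) {x}"
            using c(2) unfolding beyond_def by blast
        qed fact
        ultimately show ?thesis unfolding sep_slope_def by blast
      qed
    qed
    then show ?thesis using cardW[OF r] subW unfolding slope_separated_sets_def by blast
  qed
  moreover have "inj_on W {..<(?n - k) div 2}"
  proof (rule inj_onI)
    fix r r' assume *: "r \<in> {..<(?n - k) div 2}" "r' \<in> {..<(?n - k) div 2}" "W r = W r'"
    then have "{start r..<start r + k} = {start r'..<start r' + k}" using img by (metis lessThan_iff)
    then have "start r = start r'" using k(1) by (simp add: atLeastLessThan_eq_iff)
    then show "r = r'" by (simp add: start_def)
  qed
  ultimately have "card {..<(?n - k) div 2} \<le> card (slope_separated_sets 2 s b A k)"
    by (intro card_inj_on_le[where f = W] finite_slope_separated_sets fin) auto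
  then have "(?n - k) div 2 \<le> card (slope_separated_sets 2 s b A k)" by simp
  \<comment> \<open>From \<open>2 * k + 2 \<le> n\<close> follows
    \<open>n - k - 1 \<ge> n / 2\<close>, and rounding down loses at most one half.\<close>
  moreover have "?n \<le> 4 * ((?n - k) div 2)" using A(2) by linarith
  ultimately have "?n \<le> 4 * card (slope_separated_sets 2 s b A k)" by linarith
  then show "1 / 4 * real ?n ^ 1 \<le> real (card (slope_separated_sets 2 s b A k))" by simp
qed

section \<open>Singletons and the induction on the dimension\<close>

lemma horton_growth_single:
  assumes d: "2 \<le> d"
  shows "horton_growth (\<lambda>H. card (separated_sets b H 1)) d 1"
proof (rule horton_growthI)
  show "(0::real) < 1" by simp
  fix H assume H: "horton d H" "0 \<le> card H"
  have fin: "finite H" using H d by (intro horton_finite) auto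
  have inj: "inj_on (coord 0) H"
    using horton_strongly_general_position[OF H(1) d] d by (rule strongly_general_position_inj_first)
  have "sep y ({x} - {y})" if "x \<in> H" "y \<in> H" for x y
  proof (cases "coord 0 x" "coord 0 y" rule: linorder_cases)
    case less
    then show ?thesis unfolding sep_def by (intro exI[of _ "coord 0"]) (auto intro: linear_coord)
  next
    \<comment> \<open>Here \<open>{x} - {y}\<close> is empty, so any functional works.\<close>
    case equal
    then have "x = y" using inj that by (auto dest: inj_onD)
    then show ?thesis unfolding sep_def by (intro exI[of _ "coord 0"]) (auto intro: linear_coord)
  next
    case greater
    then show ?thesis unfolding sep_def
      by (intro exI[of _ "\<lambda>w. - coord 0 w"]) (auto intro!: linear_compose_neg linear_coord)
  qed
  then have "{x} \<in> separated_sets b H 1" if "x \<in> H" for x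
    using that unfolding separated_sets_def by (simp del: Diff_insert0)
  then have "(\<lambda>x. {x}) ` H \<subseteq> separated_sets b H 1" by blast
  then have "card H \<le> card (separated_sets b H 1)"
    by (intro card_inj_on_le[where f = "\<lambda>x. {x}"] finite_separated_sets fin) auto
  then show "1 * real (card H) ^ 1 \<le> real (card (separated_sets b H 1))" by simp
qed

text \<open>Induction on \<open>d\<close>: both halves of \<open>k\<close> are counted one dimension
  lower and their exponents add up. The value \<open>k = 1\<close> has no two positive halves and is
  treated directly.\<close>

lemma horton_growth_main:
  assumes "2 \<le> d" "1 \<le> k" "b \<longrightarrow> k \<le> 3 * 2 ^ (d - 1)"
  shows "horton_growth (\<lambda>H. card (separated_sets b H k)) d (min (2 ^ (d - 1)) k)"
  using assms
proof (induction d arbitrary: k rule: less_induct)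
  case (less d)
  have pow: "(2::nat) ^ (d - 1) = 2 * 2 ^ (d - 2)"
    using less.prems(1) by (metis Suc_diff_Suc diff_Suc_1 numeral_2_eq_2 power_Suc Suc_1 Suc_le_lessD)
  have half: "horton_growth (\<lambda>A. card (slope_separated_sets d s b A l)) d (min (2 ^ (d - 2)) l)"
    if "1 \<le> l" "b \<longrightarrow> l \<le> 3 * 2 ^ (d - 2)" "s = 1 \<or> s = - 1" for l s
  proof (cases "d = 2")
    case True
    then show ?thesis using horton_growth_plane[of l b s] that by simp
  next
    case False
    then have "3 \<le> d" using less.prems(1) by simp
    moreover have "d - 1 - 1 = d - 2" by simp
    moreover have "horton_growth (\<lambda>H. card (separated_sets b H l)) (d - 1) (min (2 ^ (d - 1 - 1)) l)"
      by (rule less.IH) (use that \<open>3 \<le> d\<close> \<open>d - 1 - 1 = d - 2\<close> in \<open>auto simp del: One_nat_def\<close>)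
    ultimately show ?thesis by (metis horton_growth_projection)
  qed
  show ?case
  proof (cases "k = 1")
    case True
    then show ?thesis using horton_growth_single[OF less.prems(1), of b] by simp
  next
    case False
    define l where "l = k div 2"
    define l' where "l' = k - k div 2"
    have sum: "l + l' = k" by (simp add: l_def l'_def)
    \<comment> \<open>The bound for holes doubles with each dimension, so both halves obey the bound
      of the previous dimension.\<close>
    have "l \<le> 3 * 2 ^ (d - 2) \<and> l' \<le> 3 * 2 ^ (d - 2)" if b
      using that less.prems(3) unfolding pow l_def l'_def by linarith
    moreover have "1 \<le> l" "1 \<le> l'" using less.prems(2) False by (auto simp: l_def l'_def)
    ultimately have "horton_growth (\<lambda>H. card (separated_sets b H (l + l'))) d
        (min (2 ^ (d - 2)) l + min (2 ^ (d - 2)) l')"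
      using less.prems(1) by (intro horton_growth_separated_sets half) auto
    \<comment> \<open>The halves differ by at most 1, so they are both at most or both at least
      \<open>2 ^ (d - 2)\<close>.\<close>
    moreover have "min (2 ^ (d - 2)) l + min (2 ^ (d - 2)) l' = min (2 ^ (d - 1)) k"
      unfolding pow l_def l'_def by (auto simp: min_def)
    ultimately show ?thesis using sum by simp
  qed
qed

lemma horton_growth_mono:
  assumes "horton_growth F d e" "\<And>H. horton d H \<Longrightarrow> F H \<le> G H"
  shows "horton_growth G d e"
  using assms unfolding horton_growth_def by (meson of_nat_mono order_trans)

lemma finite_islands: "finite H \<Longrightarrow> finite {I. is_island H k I}"
  by (rule finite_subset[of _ "Pow H"]) (auto simp: is_island_def)

theorem theorem5:
  fixes d k :: nat
  assumes "2 \<le> d" and "1 \<le> k"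
  shows "(\<exists>c>0. \<exists>N. \<forall>H. horton d H \<and> N \<le> card H \<longrightarrow>
            real (card {I. is_island H k I}) \<ge> c * real (card H) ^ min (2 ^ (d - 1)) k) \<and>
         (k \<le> 3 * 2 ^ (d - 1) \<longrightarrow>
           (\<exists>c>0. \<exists>N. \<forall>H. horton d H \<and> N \<le> card H \<longrightarrow>
              real (card {I. is_hole H k I}) \<ge> c * real (card H) ^ min (2 ^ (d - 1)) k))"
proof -
  have "horton_growth (\<lambda>H. card {I. is_island H k I}) d (min (2 ^ (d - 1)) k)"
  proof (rule horton_growth_mono)
    show "horton_growth (\<lambda>H. card (separated_sets False H k)) d (min (2 ^ (d - 1)) k)"
      using assms by (intro horton_growth_main) auto
    show "card (separated_sets False H k) \<le> card {I. is_island H k I}" if "horton d H" for H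
      using separated_sets_island horton_finite[OF that assms(1)]
      by (intro card_mono finite_islands) auto
  qed
  moreover have "horton_growth (\<lambda>H. card {I. is_hole H k I}) d (min (2 ^ (d - 1)) k)"
    if "k \<le> 3 * 2 ^ (d - 1)"
  proof (rule horton_growth_mono)
    show "horton_growth (\<lambda>H. card (separated_sets True H k)) d (min (2 ^ (d - 1)) k)"
      using assms that by (intro horton_growth_main) auto
    show "card (separated_sets True H k) \<le> card {I. is_hole H k I}" if "horton d H" for H
    proof (rule card_mono)
      show "finite {I. is_hole H k I}"
        by (rule finite_subset[OF _ finite_islands[OF horton_finite[OF that assms(1)], of k]])
          (auto simp: is_hole_def)
    qed (use separated_sets_hole in auto)
  qed
  ultimately show ?thesis unfolding horton_growth_def by blast
qed

end
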